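(* Let $\mathbb{H}\subset\mathbb{N}$ be such that $\mathcal{D}(\mathbb{H})>\frac{1}{2}$. Then every sufficiently large $n\in\mathbb{N}$ has a representation of the form $n=z_1+z_2$ with $z_1,z_2\in\mathbb{H}$.
   Context: $\mathbb{N}$ is the set of positive integers and $\mathbb{N}_n=\{m\in\mathbb{N}: m\le n\}$. For $\mathbb{H}\subset\mathbb{N}$, the density is $\mathcal{D}(\mathbb{H})=\lim_{n\to\infty}\frac{|\mathbb{H}\cap\mathbb{N}_n|}{n}$, if this limit exists and is finite; the hypothesis $\mathcal{D}(\mathbb{H})>\frac12$ includes that the limit exists. *)

theory Defs
  imports Complex_Main
begin

text \<open>Subsets of the positive integers are rendered as sets of type \<open>nat set\<close> not containing 0.\<close>

definition density_ratio :: "nat set \<Rightarrow> nat \<Rightarrow> real" where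
  "density_ratio H n = real (card (H \<inter> {1..n})) / real n"

definition density_exists :: "nat set \<Rightarrow> bool" where
  "density_exists H \<longleftrightarrow> convergent (density_ratio H)"

text \<open>Only meaningful when \<open>density_exists H\<close> holds; otherwise \<open>lim\<close> is unspecified.\<close>

definition density :: "nat set \<Rightarrow> real" where
  "density H = lim (density_ratio H)"

end

theory Submission
  imports Defs
begin

text \<open>
  The reflection \<open>z \<mapsto> n - z\<close> permutes the integers from \<open>1\<close> to \<open>n - 1\<close>.
  A set containing more than half of them must therefore meet its own mirror image, and any
  common element \<open>z\<close> gives the representation \<open>n = z + (n - z)\<close>
  (\<open>sum_of_two_if_majority\<close>).  A limiting density above \<open>1 / 2\<close> forces this majority on
  every sufficiently long initial segment.
\<close>

text \<open>
  Pigeonhole: the set and its mirror image have the same size, so if they were disjoint they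
  would together need more than the \<open>m\<close> available places.
\<close>

lemma sum_of_two_if_majority:
  fixes H :: "nat set"
  assumes majority: "m < 2 * card (H \<inter> {1..m})"
  shows "\<exists>z1\<in>H. \<exists>z2\<in>H. Suc m = z1 + z2"
proof -
  define A where "A = H \<inter> {1..m}"
  define B where "B = (\<lambda>z. Suc m - z) ` A"
  have "inj_on (\<lambda>z. Suc m - z) A"
    by (auto simp: A_def inj_on_def)
  then have card_B: "card B = card A"
    by (simp add: B_def card_image)
  have "A \<union> B \<subseteq> {1..m}"
    by (auto simp: A_def B_def)
  then have "card (A \<union> B) \<le> m"
    using card_mono[of "{1..m}" "A \<union> B"] by simp
  moreover have "finite A" "finite B"
    by (simp_all add: A_def B_def)
  ultimately have "A \<inter> B \<noteq> {}"
    using majority card_B card_Un_disjoint[of A B] by (auto simp: A_def)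
  then obtain z1 z2 where "z1 \<in> A" "z2 \<in> A" "z1 = Suc m - z2"
    by (auto simp: B_def)
  then have "z1 \<in> H" "z2 \<in> H" "Suc m = z1 + z2"
    by (auto simp: A_def)
  then show ?thesis
    by blast
qed

theorem theorem3p12:
  fixes H :: "nat set"
  assumes "H \<subseteq> {1..}"
    and "density_exists H"
    and "density H > 1 / 2"
  shows "\<exists>N. \<forall>n\<ge>N. \<exists>z1\<in>H. \<exists>z2\<in>H. n = z1 + z2"
proof -
  have "density_ratio H \<longlonglongrightarrow> density H"
    using assms(2) by (simp add: density_exists_def density_def convergent_LIMSEQ_iff)
  then have "eventually (\<lambda>m. 1 / 2 < density_ratio H m) sequentially"
    using assms(3) by (rule order_tendstoD(1))
  then obtain M where M: "\<And>m. M \<le> m \<Longrightarrow> 1 / 2 < density_ratio H m"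
    by (auto simp: eventually_sequentially)
  have "\<exists>z1\<in>H. \<exists>z2\<in>H. n = z1 + z2" if n: "Suc M \<le> n" for n
  proof -
    \<comment> \<open>Positive summands of \<open>n\<close> are at most \<open>n - 1\<close>.  Applied at \<open>n - 1\<close>, the bound
      \<open>1 / 2\<close> is itself the required majority; applied at \<open>n\<close>, it would need a margin to
      discount the point \<open>n\<close>.\<close>
    obtain m where m: "n = Suc m" "M \<le> m"
      using n by (cases n) auto
    have ratio: "1 / 2 < real (card (H \<inter> {1..m})) / real m"
      using M[OF m(2)] by (simp add: density_ratio_def)
    then have "m > 0"
      by (cases m) auto
    then have "real m < real (2 * card (H \<inter> {1..m}))"
      using ratio by (simp add: field_simps)
    then have "m < 2 * card (H \<inter> {1..m})"
      unfolding of_nat_less_iff .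
    then show ?thesis
      unfolding m(1) by (rule sum_of_two_if_majority)
  qed
  then show ?thesis
    by blast
qed

end
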